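(* Let $n\in\omega$ and let $(X,d)$ be an $\infty$-pseudometric space. Then $X$ has an integral APD profile of the form $(n+1,f)$ for some non-decreasing function $f\colon\mathbb{N}\to\mathbb{N}$ if and only if $\mathrm{trasdim}\,(X,d)\leq \omega+n$.
   Context: $\mathbb{N}$ is the set of positive integers and $\omega=\{0,1,2,\dots\}$. An $\infty$-pseudometric space is a set $X$ with a function $d\colon X\times X\to[0,\infty]$ that is symmetric, satisfies the triangle inequality and vanishes on the diagonal. Subsets of $X$ are regarded as subspaces with the restricted $d$. A family $\mathcal{U}$ of subspaces is uniformly bounded if $\mathrm{mesh}(\mathcal{U})=\sup\{\mathrm{diam}(U)\colon U\in\mathcal{U}\}$ is finite (with $\sup\emptyset=0$). For $r>0$, $\mathcal{U}$ is $r$-disjoint if $\mathrm{dist}(A,B)=\inf\{d(a,b)\colon a\in A,b\in B\}\geq r$ for any different $A,B\in\mathcal{U}$. Scale-$r$-dimension. For $x\in X$ and $r>0$, the scale-$r$-component of $x$ in $X$ is the set of all $y\in X$ for which there is a finite sequence $y=x_0,\dots,x_n=x$ in $X$ with $B(x_i,r)\cap B(x_{i+1},r)\neq\emptyset$ for each $0\leq i<n$, where $B(x,r)=\{z\in X\colon d(x,z)<r\}$ is the open ball in $X$. $X$ is of scale-$r$-dimension $0$ if the family of its scale-$r$-components is uniformly bounded. $X$ is of scale-$r$-dimension at most $n$ if it is the union of some $n+1$ subspaces of scale-$r$-dimension $0$ (components and balls of a subspace being taken inside that subspace). Integral APD profile. A finite array of non-decreasing functions $(\alpha_0,\dots,\alpha_k)$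 from $\mathbb{N}$ to $\mathbb{N}$ is an integral APD profile of $X$ if $\alpha_0$ is constant (identified with its value) and for any non-decreasing array $(r_0,\dots,r_k)$ of positive integers there is a decomposition of $X$ as the union of subsets $X_0,\dots,X_k$ such that $X_i$ has scale-$r_i$-dimension at most $\alpha_i(r_{i-1})-1$ for $1\leq i\leq k$, and $X_0$ has scale-$r_0$-dimension at most $\alpha_0-1$. Ordinal number $\mathrm{Ord}$. For a set $L$, $\mathrm{Fin}\,L$ is the family of all finite non-empty subsets of $L$. For $M\subset\mathrm{Fin}\,L$ and $a\in L$ put $M^a=\{\tau\in\mathrm{Fin}\,L\colon \tau\cup\{a\}\in M,\ a\notin\tau\}$. Define $\mathrm{Ord}\,M$ inductively: $\mathrm{Ord}\,M=0$ iff $M=\emptyset$; for an ordinal $\alpha>0$, $\mathrm{Ord}\,M\leq\alpha$ iff $\mathrm{Ord}\,M^a<\alpha$ for every $a\in L$; $\mathrm{Ord}\,M=\alpha$ iff $\mathrm{Ord}\,M\leq\alpha$ and $\mathrm{Ord}\,M<\alpha$ is not true; $\mathrm{Ord}\,M=\infty$ iff $\mathrm{Ord}\,M>\alpha$ for every ordinal $\alpha$. Transfinite asymptotic dimension. Let $\mathcal{A}(X,d)$ be the set of all $\sigma\in\mathrm{Fin}\,\mathbb{N}$ such that there is no family $(X_i)_{i\in\sigma}$ of subspaces of $X$ which covers $X$ and in which each $X_i$ is the union of some $i$-disjoint uniformly bounded family. Let $M(X,d)$ be the set of all $\sigma\in\mathrm{Fin}\,\mathbb{N}$ such that there is no family $(X_i)_{i\in\sigma}$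 of subspaces of $X$ which covers $X$ and in which each $X_i$ has scale-$i$-dimension $0$. One has $\mathrm{Ord}\,\mathcal{A}(X,d)=\mathrm{Ord}\,M(X,d)$, and this common value is $\mathrm{trasdim}\,(X,d)$. *)

theory Defs
  imports Complex_Main "HOL-Library.Extended_Nonnegative_Real" "HOL-Library.FuncSet"
    "HOL-Library.Lattice_Constructions"
begin

text \<open>
  An element of \<open>'a ordinal\<close> is the order type of a well-order on some subset of \<open>'a\<close>;
  \<open>nat ordinal\<close> is the type of all countable ordinals.
\<close>

quotient_type 'a ordinal = "'a rel" / partial: "\<lambda>r s. (r, s) \<in> ordIso"
proof (rule part_equivpI)
  have "Well_order ({} :: 'a rel)" by simp
  then show "\<exists>r :: 'a rel. (r, r) \<in> ordIso" using ordIso_reflexive by blast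
  show "symp (\<lambda>r s :: 'a rel. (r, s) \<in> ordIso)" by (auto intro: sympI ordIso_symmetric)
  show "transp (\<lambda>r s :: 'a rel. (r, s) \<in> ordIso)" by (auto intro: transpI ordIso_transitive)
qed

lemma Well_order_if_ordIso_refl: "(r, r) \<in> ordIso \<Longrightarrow> Well_order r"
  by (auto simp: ordIso_def)

instantiation ordinal :: (type) "{zero, linorder}"
begin

lift_definition zero_ordinal :: "'a ordinal" is "{}"
  by (simp add: ordIso_reflexive)

lift_definition less_eq_ordinal :: "'a ordinal \<Rightarrow> 'a ordinal \<Rightarrow> bool" is "\<lambda>r s. (r, s) \<in> ordLeq"
  by (meson ordIso_ordLeq_trans ordIso_symmetric ordLeq_ordIso_trans)

lift_definition less_ordinal :: "'a ordinal \<Rightarrow> 'a ordinal \<Rightarrow> bool" is "\<lambda>r s. (r, s) \<in> ordLess"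
  by (meson ordIso_ordLess_trans ordIso_symmetric ordLess_ordIso_trans)

instance
proof
  fix x y z :: "'a ordinal"
  show "(x < y) = (x \<le> y \<and> \<not> y \<le> x)"
    by transfer (meson Well_order_if_ordIso_refl not_ordLeq_iff_ordLess ordLeq_total not_ordLess_ordLeq)
  show "x \<le> x"
    by transfer (meson Well_order_if_ordIso_refl ordLeq_reflexive)
  show "x \<le> y \<Longrightarrow> y \<le> z \<Longrightarrow> x \<le> z"
    by transfer (meson ordLeq_transitive)
  show "x \<le> y \<Longrightarrow> y \<le> x \<Longrightarrow> x = y"
    by transfer (simp add: ordIso_iff_ordLeq)
  show "x \<le> y \<or> y \<le> x"
    by transfer (meson Well_order_if_ordIso_refl ordLeq_total)
qed

end

instance ordinal :: (type) wellorder
proof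
  fix P :: "'a ordinal \<Rightarrow> bool" and a
  assume step: "\<And>x. (\<And>y. y < x \<Longrightarrow> P y) \<Longrightarrow> P x"
  have "P (abs_ordinal r)" if "(r, r) \<in> ordIso" for r :: "'a rel"
    using that
  proof (induction r rule: wf_induct_rule[OF wf_ordLess])
    case (1 r)
    show ?case
    proof (rule step)
      fix y :: "'a ordinal" assume y: "y < abs_ordinal r"
      obtain s where s: "y = abs_ordinal s" "(s, s) \<in> ordIso"
        using ordinal.abs_induct[of "\<lambda>y. \<exists>s. y = abs_ordinal s \<and> (s, s) \<in> ordIso" y] by blast
      have "(s, r) \<in> ordLess" using y s 1 by (simp add: less_ordinal.abs_eq)
      then show "P y" using 1 s by blast
    qed
  qed
  then show "P a" using ordinal.abs_induct[of P a] by blast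
qed

lift_definition omega :: "nat ordinal" is natLeq
  by (simp add: natLeq_Well_order ordIso_reflexive)

definition succ_ordinal :: "nat ordinal \<Rightarrow> nat ordinal" where
  "succ_ordinal \<alpha> = (LEAST \<beta>. \<alpha> < \<beta>)"

text \<open>The countable ordinals have no maximum, so the least element above always exists.\<close>

lemma ex_greater_nat_ordinal: "\<exists>\<beta>. (\<alpha> :: nat ordinal) < \<beta>"
proof (transfer)
  fix r :: "nat rel" assume "(r, r) \<in> ordIso"
  then have W: "Well_order r" by (rule Well_order_if_ordIso_refl)
  define q where "q = dir_image r Suc"
  have Wq: "Well_order q" unfolding q_def by (rule Well_order_dir_image[OF W]) auto
  have iso: "(r, q) \<in> ordIso" unfolding q_def by (rule dir_image_ordIso[OF W]) auto
  have F0: "0 \<notin> Field q" by (auto simp: q_def dir_image_def Field_def)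
  define s where "s = q \<union> insert 0 (Field q) \<times> {0}"
  have Fs: "Field s = insert 0 (Field q)" by (auto simp: s_def Field_def)
  have q_props: "refl_on (Field q) q" "trans q" "antisym q" "total_on (Field q) q" "wf (q - Id)"
    using Wq by (auto simp: well_order_on_def linear_order_on_def partial_order_on_def preorder_on_def)
  have qF: "(a,b) \<in> q \<Longrightarrow> a \<in> Field q \<and> b \<in> Field q" for a b by (auto simp: Field_def)
  have wfs: "wf (s - Id)"
  proof -
    have "wf ((q - Id) \<union> Field q \<times> {0})"
    proof (rule wf_Un)
      show "wf (q - Id)" by fact
      show "wf (Field q \<times> {0::nat})"
        by (rule wf_subset[OF wf_measure[of "\<lambda>x. if x = 0 then 1 else 0"]]) (use F0 in \<open>auto intro: gr0I\<close>)
      show "Domain (q - Id) \<inter> Range (Field q \<times> {0}) = {}" using F0 qF by auto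
    qed
    moreover have "s - Id \<subseteq> (q - Id) \<union> Field q \<times> {0}" by (auto simp: s_def)
    ultimately show ?thesis by (rule wf_subset)
  qed
  have "refl_on (Field s) s" using q_props(1) unfolding refl_on_def Fs by (auto simp: s_def)
  moreover have "trans s" using q_props(2) qF F0 unfolding s_def trans_def by blast
  moreover have "antisym s" using q_props(3) qF F0 unfolding s_def antisym_def by blast
  moreover have "total_on (Field s) s" using q_props(4) unfolding total_on_def Fs by (auto simp: s_def)
  ultimately have Ws: "Well_order s" using wfs
    by (auto simp: well_order_on_def linear_order_on_def partial_order_on_def preorder_on_def Field_def)
  have U: "underS s 0 = Field q" using F0 qF by (auto simp: underS_def s_def intro: gr0I)
  have "Restr s (underS s 0) = q" using F0 qF unfolding U by (auto simp: s_def)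
  then have "(q, s) \<in> ordLess" using underS_Restr_ordLess[OF Ws, of 0] by (auto simp: Fs)
  then have "(r, s) \<in> ordLess" using iso ordIso_ordLess_trans by blast
  then show "\<exists>s::nat rel \<in> Collect (\<lambda>s. (s, s) \<in> ordIso). (r, s) \<in> ordLess" using ordIso_reflexive[OF Ws] by blast
qed

lemma less_succ_ordinal: "\<alpha> < succ_ordinal \<alpha>"
  unfolding succ_ordinal_def using ex_greater_nat_ordinal by (rule LeastI_ex)

definition omega_plus :: "nat \<Rightarrow> nat ordinal" where
  "omega_plus n = (succ_ordinal ^^ n) omega"

definition Fin :: "'a set \<Rightarrow> 'a set set" where
  "Fin L = {\<sigma>. \<sigma> \<subseteq> L \<and> finite \<sigma> \<and> \<sigma> \<noteq> {}}"

text \<open>\<open>link L M a\<close> is the family written \<open>M\<^sup>a\<close>.\<close>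

definition link :: "'a set \<Rightarrow> 'a set set \<Rightarrow> 'a \<Rightarrow> 'a set set" where
  "link L M a = {\<tau> \<in> Fin L. \<tau> \<union> {a} \<in> M \<and> a \<notin> \<tau>}"

text \<open>
  \<open>Ord_le L M \<alpha>\<close> is the inductively defined relation \<open>Ord M \<le> \<alpha>\<close> for \<open>M \<subseteq> Fin L\<close>, where
  \<open>Ord M\<^sup>a < \<alpha>\<close> is read as \<open>Ord M\<^sup>a \<le> \<beta>\<close> for some \<open>\<beta> < \<alpha>\<close>.
\<close>

inductive Ord_le :: "'a set \<Rightarrow> 'a set set \<Rightarrow> 'a ordinal \<Rightarrow> bool" for L where
  Ord_le_zero: "Ord_le L {} 0"
| Ord_le_pos: "0 < \<alpha> \<Longrightarrow> (\<And>a. a \<in> L \<Longrightarrow> \<exists>\<beta><\<alpha>. Ord_le L (link L M a) \<beta>) \<Longrightarrow> Ord_le L M \<alpha>"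

text \<open>
  \<open>top.Top\<close> is the value \<open>\<infinity>\<close>. No ordinal is lost by restricting to \<open>'a ordinal\<close>: if \<open>L\<close> is infinite,
  then \<open>Fin L\<close> has the cardinality of \<open>L\<close>, so an ordinal value of \<open>Ord M\<close> has at most that
  cardinality; if \<open>L\<close> is finite, \<open>Ord M\<close> is at most the number of elements of \<open>L\<close>.
\<close>

definition Ord :: "'a set \<Rightarrow> 'a set set \<Rightarrow> 'a ordinal top" where
  "Ord L M = (if \<exists>\<alpha>. Ord_le L M \<alpha> then top.Value (LEAST \<alpha>. Ord_le L M \<alpha>) else top.Top)"

definition infty_pseudometric :: "'a set \<Rightarrow> ('a \<Rightarrow> 'a \<Rightarrow> ennreal) \<Rightarrow> bool" where
  "infty_pseudometric X d \<longleftrightarrow>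
     (\<forall>x\<in>X. d x x = 0) \<and>
     (\<forall>x\<in>X. \<forall>y\<in>X. d x y = d y x) \<and>
     (\<forall>x\<in>X. \<forall>y\<in>X. \<forall>z\<in>X. d x z \<le> d x y + d y z)"

definition ediam :: "('a \<Rightarrow> 'a \<Rightarrow> ennreal) \<Rightarrow> 'a set \<Rightarrow> ennreal" where
  "ediam d U = (SUP x\<in>U. SUP y\<in>U. d x y)"

definition mesh :: "('a \<Rightarrow> 'a \<Rightarrow> ennreal) \<Rightarrow> 'a set set \<Rightarrow> ennreal" where
  "mesh d \<U> = (SUP U\<in>\<U>. ediam d U)"

definition uniformly_bounded :: "('a \<Rightarrow> 'a \<Rightarrow> ennreal) \<Rightarrow> 'a set set \<Rightarrow> bool" where
  "uniformly_bounded d \<U> \<longleftrightarrow> mesh d \<U> < \<infinity>"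

definition edist_sets :: "('a \<Rightarrow> 'a \<Rightarrow> ennreal) \<Rightarrow> 'a set \<Rightarrow> 'a set \<Rightarrow> ennreal" where
  "edist_sets d A B = (INF a\<in>A. INF b\<in>B. d a b)"

definition r_disjoint :: "('a \<Rightarrow> 'a \<Rightarrow> ennreal) \<Rightarrow> real \<Rightarrow> 'a set set \<Rightarrow> bool" where
  "r_disjoint d r \<U> \<longleftrightarrow> (\<forall>A\<in>\<U>. \<forall>B\<in>\<U>. A \<noteq> B \<longrightarrow> ennreal r \<le> edist_sets d A B)"

definition eball :: "('a \<Rightarrow> 'a \<Rightarrow> ennreal) \<Rightarrow> 'a set \<Rightarrow> 'a \<Rightarrow> real \<Rightarrow> 'a set" where
  "eball d X x r = {z \<in> X. d x z < ennreal r}"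

definition scale_component :: "('a \<Rightarrow> 'a \<Rightarrow> ennreal) \<Rightarrow> real \<Rightarrow> 'a set \<Rightarrow> 'a \<Rightarrow> 'a set" where
  "scale_component d r X x =
     {y. \<exists>n s. s 0 = y \<and> s n = x \<and> (\<forall>i\<le>n. s i \<in> X) \<and>
           (\<forall>i<n. eball d X (s i) r \<inter> eball d X (s (Suc i)) r \<noteq> {})}"

definition scale_dim_0 :: "('a \<Rightarrow> 'a \<Rightarrow> ennreal) \<Rightarrow> real \<Rightarrow> 'a set \<Rightarrow> bool" where
  "scale_dim_0 d r X \<longleftrightarrow> uniformly_bounded d (scale_component d r X ` X)"

definition scale_dim_le :: "('a \<Rightarrow> 'a \<Rightarrow> ennreal) \<Rightarrow> real \<Rightarrow> 'a set \<Rightarrow> nat \<Rightarrow> bool" where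
  "scale_dim_le d r X n \<longleftrightarrow> (\<exists>Y. X = (\<Union>i\<le>n. Y i) \<and> (\<forall>i\<le>n. scale_dim_0 d r (Y i)))"

definition Pos :: "nat set" where
  "Pos = {1..}"

text \<open>
  A function from the positive integers to themselves is a function on \<open>nat\<close> whose value at \<open>0\<close>
  is irrelevant. All values being positive, subtracting 1 below does not truncate.
\<close>

definition integral_APD_profile ::
    "'a set \<Rightarrow> ('a \<Rightarrow> 'a \<Rightarrow> ennreal) \<Rightarrow> (nat \<Rightarrow> nat) list \<Rightarrow> bool" where
  "integral_APD_profile X d \<alpha> \<longleftrightarrow>
     \<alpha> \<noteq> [] \<and>
     (\<forall>i<length \<alpha>. \<alpha> ! i \<in> Pos \<rightarrow> Pos \<and> mono_on Pos (\<alpha> ! i)) \<and>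
     (\<exists>c. (\<forall>m\<in>Pos. (\<alpha> ! 0) m = c) \<and>
       (\<forall>r. length r = length \<alpha> \<and> set r \<subseteq> Pos \<and> sorted r \<longrightarrow>
         (\<exists>Y. X = (\<Union>i<length \<alpha>. Y i) \<and>
            scale_dim_le d (real (r ! 0)) (Y 0) (c - 1) \<and>
            (\<forall>i. 1 \<le> i \<and> i < length \<alpha> \<longrightarrow>
               scale_dim_le d (real (r ! i)) (Y i) ((\<alpha> ! i) (r ! (i - 1)) - 1)))))"

definition trasdim_family :: "'a set \<Rightarrow> ('a \<Rightarrow> 'a \<Rightarrow> ennreal) \<Rightarrow> nat set set" where
  "trasdim_family X d =
     {\<sigma> \<in> Fin Pos. \<not> (\<exists>Y. X = (\<Union>i\<in>\<sigma>. Y i) \<and>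
        (\<forall>i\<in>\<sigma>. \<exists>\<U>. Y i = \<Union>\<U> \<and> r_disjoint d (real i) \<U> \<and> uniformly_bounded d \<U>))}"

definition trasdim :: "'a set \<Rightarrow> ('a \<Rightarrow> 'a \<Rightarrow> ennreal) \<Rightarrow> nat ordinal top" where
  "trasdim X d = Ord Pos (trasdim_family X d)"

end

theory Submission
  imports Defs
begin

text \<open>
  Both sides say that large index sets admit covers. Write \<open>\<A>\<close> for the family \<open>trasdim_family X d\<close> of
  those \<open>\<sigma>\<close> for which no cover \<open>(X\<^sub>i)\<^sub>i\<^sub>\<in>\<^sub>\<sigma>\<close> by sets of scale-\<open>i\<close>-dimension \<open>0\<close> exists.

  Passing from a family to a link removes one point from its members and lowers a positive order.
  Since a family has finite order at most \<open>k\<close> exactly when its members have at most \<open>k\<close> elements, and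
  since an ordinal below \<open>\<omega>\<close> is finite, \<open>Ord \<A> \<le> \<omega> + n\<close> means that after fixing \<open>n + 1\<close> points the
  cardinalities are bounded: for every \<open>S\<close> with \<open>n + 1\<close> elements there is \<open>m\<close> such that each
  \<open>\<sigma> \<in> \<A>\<close> containing \<open>S\<close> has at most \<open>m\<close> elements (\<open>Ord_le_omega_plus_iff\<close>).

  Such bounds are the values of \<open>f\<close> in a profile \<open>(n + 1, f)\<close>. The link is that a union of \<open>k\<close> sets of
  dimension \<open>0\<close> at one scale can be indexed by any \<open>k\<close> numbers not exceeding that scale, because
  dimension \<open>0\<close> persists at smaller scales.
  Given a profile and \<open>\<sigma> \<supseteq> S\<close>, decompose \<open>X\<close> at the scales \<open>Max S \<le> Max \<sigma>\<close>: the \<open>n + 1\<close> sets of the first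
  part are indexed by \<open>S\<close> and the \<open>f (Max S)\<close> sets of the second by \<open>\<sigma> - S\<close>, so \<open>\<sigma> \<notin> \<A>\<close> as soon as
  \<open>\<sigma> - S\<close> has that many elements (\<open>card_le_if_profile\<close>). Conversely, for scales \<open>p \<le> q\<close> let \<open>\<sigma>\<close> consist
  of \<open>S = {p..p + n}\<close> and of as many numbers above \<open>S\<close> and at least \<open>q\<close> as are needed to
  exceed the bound for \<open>S\<close>. That number depends on \<open>p\<close> alone, and a cover witnessing \<open>\<sigma> \<notin> \<A>\<close>
  is the required decomposition (\<open>decomposition_if_card_le\<close>).
\<close>

section \<open>Ordinals up to \<open>\<omega> + n\<close>\<close>

lemma less_succ_ordinal_iff: "\<beta> < succ_ordinal \<alpha> \<longleftrightarrow> \<beta> \<le> \<alpha>"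
proof
  assume "\<beta> < succ_ordinal \<alpha>"
  then show "\<beta> \<le> \<alpha>"
    unfolding succ_ordinal_def using not_less_Least[of \<beta> "\<lambda>\<beta>. \<alpha> < \<beta>"] by auto
next
  assume "\<beta> \<le> \<alpha>"
  then show "\<beta> < succ_ordinal \<alpha>"
    using less_succ_ordinal[of \<alpha>] by simp
qed

lift_definition fin_ordinal :: "nat \<Rightarrow> nat ordinal" is natLeq_on
  by (intro ordIso_reflexive natLeq_on_Well_order)

lemma strict_mono_fin_ordinal: "strict_mono fin_ordinal"
proof (rule strict_monoI, transfer)
  fix j k :: nat
  assume "j < k"
  then have "Restr (natLeq_on k) (underS (natLeq_on k) j) = natLeq_on j"
    by (auto simp: underS_def)
  moreover have "j \<in> Field (natLeq_on k)"
    using \<open>j < k\<close> by (simp add: Field_natLeq_on)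
  ultimately show "(natLeq_on j, natLeq_on k) \<in> ordLess"
    using underS_Restr_ordLess[OF natLeq_on_Well_order, of k j] by auto
qed

lemma fin_ordinal_0: "fin_ordinal 0 = 0"
  by transfer (simp add: ordIso_reflexive)

text \<open>
  A well-order shorter than \<open>natLeq\<close> is isomorphic to a proper initial segment of it, and these are
  the orders \<open>natLeq_on k\<close>.
\<close>

lemma less_omega_iff: "\<beta> < omega \<longleftrightarrow> (\<exists>k. \<beta> = fin_ordinal k)"
proof transfer
  fix r :: "nat rel"
  assume "(r, r) \<in> ordIso"
  then have r: "Well_order r"
    by (rule Well_order_if_ordIso_refl)
  have "(r, natLeq) \<in> ordLess \<longleftrightarrow> (\<exists>k. (r, Restr natLeq (underS natLeq k)) \<in> ordIso)"
    using ordLess_iff_ordIso_Restr[OF natLeq_Well_order r] by (simp add: Field_natLeq)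
  moreover have "Restr natLeq (underS natLeq k) = natLeq_on k" for k
    by (auto simp: natLeq_def underS_def)
  ultimately show "(r, natLeq) \<in> ordLess \<longleftrightarrow> (\<exists>k. (r, natLeq_on k) \<in> ordIso)"
    by simp
qed

lemma less_fin_ordinal_Suc_iff: "\<beta> < fin_ordinal (Suc k) \<longleftrightarrow> \<beta> \<le> fin_ordinal k"
proof
  assume less: "\<beta> < fin_ordinal (Suc k)"
  moreover have "fin_ordinal (Suc k) < omega"
    by (auto simp: less_omega_iff)
  ultimately have "\<beta> < omega"
    by (rule less_trans)
  then show "\<beta> \<le> fin_ordinal k"
    using less by (auto simp: less_omega_iff strict_mono_less[OF strict_mono_fin_ordinal] strict_mono_less_eq[OF strict_mono_fin_ordinal])
next
  assume "\<beta> \<le> fin_ordinal k"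
  also have "fin_ordinal k < fin_ordinal (Suc k)"
    by (simp add: strict_mono_less[OF strict_mono_fin_ordinal])
  finally show "\<beta> < fin_ordinal (Suc k)" .
qed

lemma zero_ordinal_le: "(0 :: 'a ordinal) \<le> \<alpha>"
proof -
  have "\<not> \<alpha> < 0"
    by transfer (simp add: ordLess_iff_ordIso_Restr Well_order_if_ordIso_refl)
  then show ?thesis
    by simp
qed

section \<open>Families of order at most \<open>\<omega> + n\<close>\<close>

lemma Ord_le_0_iff: "Ord_le L M 0 \<longleftrightarrow> M = {}"
  by (auto elim: Ord_le.cases intro: Ord_le_zero)

lemma Ord_le_pos_iff:
  assumes "0 < \<alpha>"
  shows "Ord_le L M \<alpha> \<longleftrightarrow> (\<forall>a\<in>L. \<exists>\<beta><\<alpha>. Ord_le L (link L M a) \<beta>)"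
  using assms by (auto elim: Ord_le.cases intro: Ord_le_pos)

lemma Ord_le_mono:
  assumes "Ord_le L M \<alpha>" "\<alpha> \<le> \<beta>"
  shows "Ord_le L M \<beta>"
proof (cases "\<alpha> = 0")
  case True
  then have "M = {}"
    using assms by (simp add: Ord_le_0_iff)
  show ?thesis
  proof (cases "\<beta> = 0")
    case False
    then have "0 < \<beta>"
      using zero_ordinal_le[of \<beta>] by simp
    moreover have "Ord_le L (link L M a) 0" for a
      using \<open>M = {}\<close> by (simp add: Ord_le_0_iff link_def)
    ultimately show ?thesis
      by (blast intro: Ord_le_pos)
  qed (use \<open>M = {}\<close> in \<open>simp add: Ord_le_0_iff\<close>)
next
  case False
  then have "0 < \<alpha>" "0 < \<beta>"
    using assms zero_ordinal_le[of \<alpha>] by auto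
  then show ?thesis
    using assms by (meson Ord_le_pos_iff less_le_trans)
qed

text \<open>
  By monotonicity, the bound \<open>\<beta> < \<gamma>\<close> that the definition asks for separately at each point may always
  be taken to be the predecessor \<open>\<delta>\<close> of \<open>\<gamma>\<close>.
\<close>

lemma Ord_le_iff_link_if_successor:
  assumes "\<And>\<beta>. \<beta> < \<gamma> \<longleftrightarrow> \<beta> \<le> \<delta>"
  shows "Ord_le L M \<gamma> \<longleftrightarrow> (\<forall>a\<in>L. Ord_le L (link L M a) \<delta>)"
proof -
  have "0 < \<gamma>"
    by (simp add: assms zero_ordinal_le)
  then show ?thesis
    unfolding Ord_le_pos_iff[OF \<open>0 < \<gamma>\<close>] assms by (meson Ord_le_mono order_refl)
qed

lemma link_subset_Fin: "link L M a \<subseteq> Fin L"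
  by (auto simp: link_def)

text \<open>
  Members of a link are members of \<open>M\<close> with a point removed. Iterated links thereby turn into
  conditions on \<open>M\<close> itself; the singleton \<open>{a}\<close> is excluded because \<open>Fin\<close> omits the empty set.
\<close>

lemma Ball_link_iff:
  assumes "M \<subseteq> Fin L"
  shows "(\<forall>\<tau>\<in>link L M a. P \<tau>) \<longleftrightarrow> (\<forall>\<sigma>\<in>M. a \<in> \<sigma> \<and> \<sigma> \<noteq> {a} \<longrightarrow> P (\<sigma> - {a}))"
proof (intro iffI ballI impI)
  fix \<sigma> assume *: "\<forall>\<tau>\<in>link L M a. P \<tau>" "\<sigma> \<in> M" "a \<in> \<sigma> \<and> \<sigma> \<noteq> {a}"
  then have "\<sigma> - {a} \<in> link L M a"
    using assms by (auto simp: link_def Fin_def insert_absorb)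
  with * show "P (\<sigma> - {a})"
    by blast
next
  fix \<tau> assume *: "\<forall>\<sigma>\<in>M. a \<in> \<sigma> \<and> \<sigma> \<noteq> {a} \<longrightarrow> P (\<sigma> - {a})" "\<tau> \<in> link L M a"
  then have "insert a \<tau> \<in> M" "a \<notin> \<tau>" "\<tau> \<noteq> {}"
    by (auto simp: link_def Fin_def)
  with * show "P \<tau>"
    by (metis Diff_insert_absorb insertI1 singleton_insert_inj_eq subset_singletonD)
qed

lemma card_le_Suc_iff_remove:
  assumes "M \<subseteq> Fin L" "\<sigma> \<in> M" "a \<in> \<sigma>"
  shows "card \<sigma> \<le> Suc k \<longleftrightarrow> (\<sigma> \<noteq> {a} \<longrightarrow> card (\<sigma> - {a}) \<le> k)"
proof -
  have "finite \<sigma>"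
    using assms by (auto simp: Fin_def)
  then show ?thesis
    using assms by (auto simp: card_Diff_singleton)
qed

lemma Ord_le_fin_ordinal_iff:
  assumes "M \<subseteq> Fin L"
  shows "Ord_le L M (fin_ordinal k) \<longleftrightarrow> (\<forall>\<sigma>\<in>M. card \<sigma> \<le> k)"
  using assms
proof (induction k arbitrary: M)
  case 0
  then have "\<sigma> \<in> M \<Longrightarrow> card \<sigma> \<noteq> 0" for \<sigma>
    by (auto simp: Fin_def)
  then show ?case
    by (auto simp: fin_ordinal_0 Ord_le_0_iff)
next
  case (Suc k)
  have "Ord_le L M (fin_ordinal (Suc k)) \<longleftrightarrow>
      (\<forall>a\<in>L. \<forall>\<sigma>\<in>M. a \<in> \<sigma> \<and> \<sigma> \<noteq> {a} \<longrightarrow> card (\<sigma> - {a}) \<le> k)"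
    unfolding Ord_le_iff_link_if_successor[OF less_fin_ordinal_Suc_iff]
      Suc.IH[OF link_subset_Fin] Ball_link_iff[OF Suc.prems] ..
  also have "\<dots> \<longleftrightarrow> (\<forall>\<sigma>\<in>M. \<forall>a\<in>L. a \<in> \<sigma> \<longrightarrow> card \<sigma> \<le> Suc k)"
    using card_le_Suc_iff_remove[OF Suc.prems] by blast
  also have "\<dots> \<longleftrightarrow> (\<forall>\<sigma>\<in>M. card \<sigma> \<le> Suc k)"
    using Suc.prems unfolding Fin_def by blast
  finally show ?case .
qed

text \<open>
  Taking the link at \<open>a\<close> goes down from \<open>\<omega> + (n + 1)\<close> to \<open>\<omega> + n\<close> and adds \<open>a\<close> to the fixed set \<open>S\<close>. At
  \<open>\<omega>\<close>, the link at each point has finite order, that is, bounded cardinalities, with a bound that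
  depends on the point; this is why \<open>S\<close> has \<open>n + 1\<close> elements and not \<open>n\<close>.
\<close>

lemma Ord_le_omega_plus_iff:
  assumes "M \<subseteq> Fin L"
  shows "Ord_le L M (omega_plus n) \<longleftrightarrow>
    (\<forall>S\<subseteq>L. card S = Suc n \<longrightarrow> (\<exists>m. \<forall>\<sigma>\<in>M. S \<subseteq> \<sigma> \<longrightarrow> card \<sigma> \<le> m))"
  using assms
proof (induction n arbitrary: M)
  case 0
  have pos: "0 < omega"
    unfolding less_omega_iff using fin_ordinal_0 by metis
  have "Ord_le L M (omega_plus 0) \<longleftrightarrow> (\<forall>a\<in>L. \<exists>\<beta><omega. Ord_le L (link L M a) \<beta>)"
    by (simp add: omega_plus_def Ord_le_pos_iff[OF pos])
  also have "\<dots> \<longleftrightarrow> (\<forall>a\<in>L. \<exists>k. Ord_le L (link L M a) (fin_ordinal k))"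
    by (auto simp: less_omega_iff)
  also have "\<dots> \<longleftrightarrow> (\<forall>a\<in>L. \<exists>k. \<forall>\<sigma>\<in>M. a \<in> \<sigma> \<and> \<sigma> \<noteq> {a} \<longrightarrow> card (\<sigma> - {a}) \<le> k)"
    unfolding Ord_le_fin_ordinal_iff[OF link_subset_Fin] Ball_link_iff[OF 0] ..
  also have "\<dots> \<longleftrightarrow> (\<forall>a\<in>L. \<exists>k. \<forall>\<sigma>\<in>M. a \<in> \<sigma> \<longrightarrow> card \<sigma> \<le> Suc k)"
  proof -
    have "(\<forall>\<sigma>\<in>M. a \<in> \<sigma> \<and> \<sigma> \<noteq> {a} \<longrightarrow> card (\<sigma> - {a}) \<le> k) \<longleftrightarrow>
        (\<forall>\<sigma>\<in>M. a \<in> \<sigma> \<longrightarrow> card \<sigma> \<le> Suc k)" for a k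
      using card_le_Suc_iff_remove[OF 0] by blast
    then show ?thesis
      by simp
  qed
  also have "\<dots> \<longleftrightarrow> (\<forall>a\<in>L. \<exists>m. \<forall>\<sigma>\<in>M. a \<in> \<sigma> \<longrightarrow> card \<sigma> \<le> m)"
    by (meson le_SucI)
  also have "\<dots> \<longleftrightarrow> (\<forall>S\<subseteq>L. card S = Suc 0 \<longrightarrow> (\<exists>m. \<forall>\<sigma>\<in>M. S \<subseteq> \<sigma> \<longrightarrow> card \<sigma> \<le> m))"
  proof -
    have "(\<forall>S\<subseteq>L. card S = Suc 0 \<longrightarrow> P S) \<longleftrightarrow> (\<forall>a\<in>L. P {a})" for P
      by (auto simp: card_1_singleton_iff)
    then show ?thesis
      by simp
  qed
  finally show ?case .
next
  case (Suc n)
  have succ: "\<beta> < omega_plus (Suc n) \<longleftrightarrow> \<beta> \<le> omega_plus n" for \<beta>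
    by (simp add: omega_plus_def less_succ_ordinal_iff)
  have "Ord_le L M (omega_plus (Suc n)) \<longleftrightarrow>
      (\<forall>a\<in>L. \<forall>S\<subseteq>L. card S = Suc n \<longrightarrow>
        (\<exists>m. \<forall>\<sigma>\<in>M. a \<in> \<sigma> \<and> \<sigma> \<noteq> {a} \<longrightarrow> S \<subseteq> \<sigma> - {a} \<longrightarrow> card (\<sigma> - {a}) \<le> m))"
    unfolding Ord_le_iff_link_if_successor[OF succ] Suc.IH[OF link_subset_Fin]
      Ball_link_iff[OF Suc.prems] ..
  also have "\<dots> \<longleftrightarrow>
      (\<forall>S\<subseteq>L. card S = Suc (Suc n) \<longrightarrow> (\<exists>m. \<forall>\<sigma>\<in>M. S \<subseteq> \<sigma> \<longrightarrow> card \<sigma> \<le> m))"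
    (is "?links \<longleftrightarrow> ?M")
  proof
    assume links: ?links
    show ?M
    proof (intro allI impI)
      fix S assume S: "S \<subseteq> L" "card S = Suc (Suc n)"
      then obtain a T where T: "S = insert a T" "a \<notin> T" "card T = Suc n"
        by (metis card_Suc_eq)
      then obtain m where
        m: "\<forall>\<sigma>\<in>M. a \<in> \<sigma> \<and> \<sigma> \<noteq> {a} \<longrightarrow> T \<subseteq> \<sigma> - {a} \<longrightarrow> card (\<sigma> - {a}) \<le> m"
        using links S by (metis insert_subset)
      have "card \<sigma> \<le> Suc m" if "\<sigma> \<in> M" "S \<subseteq> \<sigma>" for \<sigma>
        using that m T card_le_Suc_iff_remove[OF Suc.prems \<open>\<sigma> \<in> M\<close>, of a m] by blast
      then show "\<exists>m. \<forall>\<sigma>\<in>M. S \<subseteq> \<sigma> \<longrightarrow> card \<sigma> \<le> m"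
        by blast
    qed
  next
    assume M: ?M
    show ?links
    proof (intro ballI allI impI)
      fix a S assume S: "a \<in> L" "S \<subseteq> L" "card S = Suc n"
      show "\<exists>m. \<forall>\<sigma>\<in>M. a \<in> \<sigma> \<and> \<sigma> \<noteq> {a} \<longrightarrow> S \<subseteq> \<sigma> - {a} \<longrightarrow> card (\<sigma> - {a}) \<le> m"
      \<comment> \<open>If \<open>a \<in> S\<close>, then no \<open>\<sigma> - {a}\<close> contains \<open>S\<close> and any \<open>m\<close> will do.\<close>
      proof (cases "a \<in> S")
        case False
        have "finite S"
          using S by (simp add: card_ge_0_finite)
        then have "card (insert a S) = Suc (Suc n)"
          using S False by simp
        then obtain m where m: "\<forall>\<sigma>\<in>M. insert a S \<subseteq> \<sigma> \<longrightarrow> card \<sigma> \<le> m"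
          using M S by (metis insert_subset)
        have "card (\<sigma> - {a}) \<le> m" if "\<sigma> \<in> M" "a \<in> \<sigma>" "S \<subseteq> \<sigma> - {a}" for \<sigma>
        proof -
          have "card \<sigma> \<le> m"
            using m that by auto
          then show ?thesis
            using card_Diff1_le[of \<sigma> a] by linarith
        qed
        then show ?thesis
          by blast
      qed auto
    qed
  qed
  finally show ?case .
qed

lemma Ord_le_Value_iff: "Ord L M \<le> top.Value \<alpha> \<longleftrightarrow> Ord_le L M \<alpha>"
proof (cases "\<exists>\<beta>. Ord_le L M \<beta>")
  case True
  then have "Ord_le L M (LEAST \<beta>. Ord_le L M \<beta>)"
    by (rule LeastI_ex)
  then show ?thesis
    using True by (auto simp: Ord_def intro: Ord_le_mono Least_le)
qed (auto simp: Ord_def)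

section \<open>Scale-\<open>r\<close>-dimension zero\<close>

lemma uniformly_bounded_iff:
  "uniformly_bounded d \<U> \<longleftrightarrow> (\<exists>C<\<infinity>. \<forall>U\<in>\<U>. \<forall>x\<in>U. \<forall>y\<in>U. d x y \<le> C)"
proof -
  have "mesh d \<U> \<le> C \<longleftrightarrow> (\<forall>U\<in>\<U>. \<forall>x\<in>U. \<forall>y\<in>U. d x y \<le> C)" for C
    by (simp add: mesh_def ediam_def SUP_le_iff)
  then show ?thesis
    unfolding uniformly_bounded_def by (meson le_less_trans order_refl)
qed

lemma le_edist_sets_iff: "c \<le> edist_sets d A B \<longleftrightarrow> (\<forall>a\<in>A. \<forall>b\<in>B. c \<le> d a b)"
  by (simp add: edist_sets_def le_INF_iff)

text \<open>
  Scale components are the classes of the equivalence relation generated by this relation, so that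
  reasoning about chains becomes induction on reflexive transitive closures.
\<close>

definition scale_step :: "('a \<Rightarrow> 'a \<Rightarrow> ennreal) \<Rightarrow> real \<Rightarrow> 'a set \<Rightarrow> 'a rel" where
  "scale_step d r Y = {(x, y). x \<in> Y \<and> y \<in> Y \<and> eball d Y x r \<inter> eball d Y y r \<noteq> {}}"

lemma scale_component_eq:
  assumes "x \<in> Y"
  shows "scale_component d r Y x = {y. (y, x) \<in> (scale_step d r Y)\<^sup>*}"
proof -
  have "(\<exists>s. s 0 = y \<and> s n = x \<and> (\<forall>i\<le>n. s i \<in> Y) \<and>
      (\<forall>i<n. eball d Y (s i) r \<inter> eball d Y (s (Suc i)) r \<noteq> {})) \<longleftrightarrow>
    (y, x) \<in> scale_step d r Y ^^ n" for y n
    unfolding relpow_fun_conv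
  proof (intro ex_cong1 iffI conjI; (elim conjE)?)
    fix s assume s: "s 0 = y" "s n = x" "\<forall>i<n. (s i, s (Suc i)) \<in> scale_step d r Y"
    show "\<forall>i\<le>n. s i \<in> Y"
      using s assms by (auto simp: scale_step_def le_less)
  qed (auto simp: scale_step_def)
  then show ?thesis
    unfolding scale_component_def rtrancl_power by auto
qed

text \<open>
  Shrinking the scale or the set shrinks the balls, hence the components. This is what lets a single
  large scale serve all smaller indices.
\<close>

lemma scale_dim_0_subset:
  assumes "scale_dim_0 d r Y" "r' \<le> r" "Z \<subseteq> Y"
  shows "scale_dim_0 d r' Z"
proof -
  have "eball d Z x r' \<subseteq> eball d Y x r" for x
    using assms ennreal_leI[of r' r] by (auto simp: eball_def intro: less_le_trans)
  then have "scale_step d r' Z \<subseteq> scale_step d r Y"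
    using \<open>Z \<subseteq> Y\<close> unfolding scale_step_def by blast
  then have sub: "scale_component d r' Z x \<subseteq> scale_component d r Y x" if "x \<in> Z" for x
    using that \<open>Z \<subseteq> Y\<close> rtrancl_mono[of "scale_step d r' Z" "scale_step d r Y"]
    by (auto simp: scale_component_eq[of x Z] scale_component_eq[of x Y] subset_iff)
  obtain C where C: "C < \<infinity>"
    "\<forall>x\<in>Y. \<forall>y\<in>scale_component d r Y x. \<forall>z\<in>scale_component d r Y x. d y z \<le> C"
    using assms(1) unfolding scale_dim_0_def uniformly_bounded_iff ball_simps by blast
  then have "\<forall>x\<in>Z. \<forall>y\<in>scale_component d r' Z x. \<forall>z\<in>scale_component d r' Z x. d y z \<le> C"
    using sub \<open>Z \<subseteq> Y\<close> by blast
  then show ?thesis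
    using C(1) unfolding scale_dim_0_def uniformly_bounded_iff ball_simps by blast
qed

lemma scale_dim_0_empty: "scale_dim_0 d r {}"
  unfolding scale_dim_0_def uniformly_bounded_iff by (intro exI[of _ 0]) simp

text \<open>
  Points at distance less than \<open>r\<close> have a common point in their balls, so distinct components are
  \<open>r\<close>-disjoint. Conversely, a member of an \<open>r\<close>-disjoint cover of \<open>Y\<close> contains all points of \<open>Y\<close> at
  distance less than \<open>r\<close> from it. If two balls meet in \<open>w\<close>, such a member containing one centre
  therefore contains \<open>w\<close> and then the other centre; hence no chain leaves it and it contains a whole
  component. The scale is the same on both sides because the balls are taken inside \<open>Y\<close>.
\<close>

lemma scale_dim_0_iff_r_disjoint_family:
  assumes pm: "infty_pseudometric X d" and "Y \<subseteq> X" and "0 < r"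
  shows "scale_dim_0 d r Y \<longleftrightarrow>
    (\<exists>\<U>. Y = \<Union>\<U> \<and> r_disjoint d r \<U> \<and> uniformly_bounded d \<U>)"
proof
  assume bounded: "scale_dim_0 d r Y"
  let ?E = "scale_step d r Y"
  have "sym (?E\<^sup>*)"
    by (rule sym_rtrancl) (auto simp: sym_def scale_step_def)
  then have same: "scale_component d r Y x = scale_component d r Y y"
    if "x \<in> Y" "y \<in> Y" "(x, y) \<in> ?E\<^sup>*" for x y
    using that unfolding scale_component_eq[OF that(1)] scale_component_eq[OF that(2)] sym_def
    by (blast intro: rtrancl_trans)
  have in_Y: "y \<in> Y" if "x \<in> Y" "(y, x) \<in> ?E\<^sup>*" for x y
    using that(2,1) by (induction rule: converse_rtrancl_induct) (auto simp: scale_step_def)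
  have "Y = \<Union> (scale_component d r Y ` Y)"
    using in_Y by (auto simp: scale_component_eq)
  moreover have "r_disjoint d r (scale_component d r Y ` Y)"
    unfolding r_disjoint_def le_edist_sets_iff
  proof (intro ballI impI, elim imageE, rule ccontr)
    fix A B a b x y
    assume ne: "A \<noteq> B" and a: "a \<in> A" and b: "b \<in> B" and less: "\<not> ennreal r \<le> d a b"
      and A: "A = scale_component d r Y x" "x \<in> Y" and B: "B = scale_component d r Y y" "y \<in> Y"
    have aY: "a \<in> Y" and bY: "b \<in> Y" and ax: "(a, x) \<in> ?E\<^sup>*" and by': "(b, y) \<in> ?E\<^sup>*"
      using a b A B in_Y by (auto simp: scale_component_eq)
    have "d b b = 0"
      using pm bY \<open>Y \<subseteq> X\<close> by (auto simp: infty_pseudometric_def)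
    \<comment> \<open>The balls around \<open>a\<close> and \<open>b\<close> meet in \<open>b\<close>.\<close>
    then have "(a, b) \<in> ?E"
      using less aY bY \<open>0 < r\<close> by (auto simp: scale_step_def eball_def)
    then have "scale_component d r Y a = scale_component d r Y b"
      using same aY bY by blast
    then have "A = B"
      using same[OF aY \<open>x \<in> Y\<close> ax] same[OF bY \<open>y \<in> Y\<close> by'] A B by simp
    then show False
      using ne by simp
  qed
  ultimately show "\<exists>\<U>. Y = \<Union>\<U> \<and> r_disjoint d r \<U> \<and> uniformly_bounded d \<U>"
    using bounded unfolding scale_dim_0_def by blast
next
  assume "\<exists>\<U>. Y = \<Union>\<U> \<and> r_disjoint d r \<U> \<and> uniformly_bounded d \<U>"
  then obtain \<U> C where Y: "Y = \<Union>\<U>"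
    and disj: "r_disjoint d r \<U>"
    and C: "C < \<infinity>" "\<forall>U\<in>\<U>. \<forall>x\<in>U. \<forall>y\<in>U. d x y \<le> C"
    unfolding uniformly_bounded_iff by blast
  have close: "w \<in> A" if "A \<in> \<U>" "z \<in> A" "w \<in> Y" "d z w < ennreal r" for z w A
    using that disj unfolding r_disjoint_def le_edist_sets_iff Y
    by (metis UnionE not_le)
  have step: "y \<in> A" if "A \<in> \<U>" "z \<in> A" and yz: "(y, z) \<in> scale_step d r Y" for y z A
  proof -
    obtain w where w: "w \<in> Y" "y \<in> Y" "d y w < ennreal r" "d z w < ennreal r"
      using yz by (auto simp: scale_step_def eball_def)
    moreover have "d w y = d y w"
      using pm w \<open>Y \<subseteq> X\<close> unfolding infty_pseudometric_def by blast
    ultimately show ?thesis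
      using close[OF that(1,2)] close[OF that(1), of w y] by simp
  qed
  have chain: "y \<in> A" if "(y, x) \<in> (scale_step d r Y)\<^sup>*" "A \<in> \<U>" "x \<in> A" for x y A
    using that by (induction rule: converse_rtrancl_induct) (auto intro: step)
  have "d y z \<le> C" if "x \<in> Y" "y \<in> scale_component d r Y x" "z \<in> scale_component d r Y x" for x y z
  proof -
    obtain A where A: "A \<in> \<U>" "x \<in> A"
      using \<open>x \<in> Y\<close> Y by blast
    then have "y \<in> A" "z \<in> A"
      using that chain by (auto simp: scale_component_eq)
    then show ?thesis
      using C A by blast
  qed
  then show "scale_dim_0 d r Y"
    using C(1) unfolding scale_dim_0_def uniformly_bounded_iff ball_simps by blast
qed

lemma not_in_trasdim_family_iff:
  assumes pm: "infty_pseudometric X d" and \<sigma>: "\<sigma> \<in> Fin Pos"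
  shows "\<sigma> \<notin> trasdim_family X d \<longleftrightarrow>
    (\<exists>Y. X = (\<Union>i\<in>\<sigma>. Y i) \<and> (\<forall>i\<in>\<sigma>. scale_dim_0 d (real i) (Y i)))"
proof -
  have "scale_dim_0 d (real i) (Y i) \<longleftrightarrow>
      (\<exists>\<U>. Y i = \<Union>\<U> \<and> r_disjoint d (real i) \<U> \<and> uniformly_bounded d \<U>)"
    if "X = (\<Union>i\<in>\<sigma>. Y i)" "i \<in> \<sigma>" for Y :: "nat \<Rightarrow> 'a set" and i
    by (rule scale_dim_0_iff_r_disjoint_family[OF pm])
      (use that \<sigma> in \<open>auto simp: Fin_def Pos_def\<close>)
  then have "(X = (\<Union>i\<in>\<sigma>. Y i) \<and> (\<forall>i\<in>\<sigma>. scale_dim_0 d (real i) (Y i))) \<longleftrightarrow>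
      (X = (\<Union>i\<in>\<sigma>. Y i) \<and> (\<forall>i\<in>\<sigma>. \<exists>\<U>. Y i = \<Union>\<U> \<and>
        r_disjoint d (real i) \<U> \<and> uniformly_bounded d \<U>))" for Y :: "nat \<Rightarrow> 'a set"
    by (intro conj_cong ball_cong refl)
  then show ?thesis
    using \<sigma> unfolding trasdim_family_def mem_Collect_eq by (simp only: de_Morgan_conj) blast
qed

section \<open>Unions of sets of scale-\<open>r\<close>-dimension zero\<close>

text \<open>
  The sets of a decomposition may be indexed by an arbitrary finite set in place of an initial
  segment; below, the indices are scales.
\<close>

lemma scale_dim_le_card_iff:
  assumes "finite T" "T \<noteq> {}"
  shows "scale_dim_le d r Y (card T - 1) \<longleftrightarrow>
    (\<exists>Z. Y = (\<Union>i\<in>T. Z i) \<and> (\<forall>i\<in>T. scale_dim_0 d r (Z i)))"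
proof -
  have eq: "{..card T - 1} = {0..<card T}"
    using card_gt_0_iff[of T] assms by auto
  obtain h where "bij_betw h {0..<card T} T"
    using ex_bij_betw_nat_finite[OF assms(1)] by blast
  then have h: "bij_betw h {..card T - 1} T"
    by (simp only: eq)
  then have im: "h ` {..card T - 1} = T"
    by (simp add: bij_betw_def)
  show ?thesis
  proof
    assume "scale_dim_le d r Y (card T - 1)"
    then obtain Z where Z: "Y = (\<Union>i\<le>card T - 1. Z i)" "\<forall>i\<le>card T - 1. scale_dim_0 d r (Z i)"
      unfolding scale_dim_le_def by blast
    let ?g = "the_inv_into {..card T - 1} h"
    have g: "?g ` T = {..card T - 1}"
      using bij_betw_the_inv_into[OF h] by (simp add: bij_betw_def)
    have "Y = (\<Union>i\<in>T. Z (?g i))"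
      using Z(1) g by (metis image_image)
    moreover have "\<forall>i\<in>T. scale_dim_0 d r (Z (?g i))"
      using Z(2) g by blast
    ultimately show "\<exists>Z. Y = (\<Union>i\<in>T. Z i) \<and> (\<forall>i\<in>T. scale_dim_0 d r (Z i))"
      by (intro exI[of _ "\<lambda>i. Z (?g i)"] conjI)
  next
    assume "\<exists>Z. Y = (\<Union>i\<in>T. Z i) \<and> (\<forall>i\<in>T. scale_dim_0 d r (Z i))"
    then obtain Z where Z: "Y = (\<Union>i\<in>T. Z i)" "\<forall>i\<in>T. scale_dim_0 d r (Z i)"
      by blast
    have "Y = (\<Union>i\<le>card T - 1. Z (h i))"
      using Z(1) im by (metis image_image)
    moreover have "\<forall>i\<le>card T - 1. scale_dim_0 d r (Z (h i))"
      using Z(2) im by blast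
    ultimately show "scale_dim_le d r Y (card T - 1)"
      unfolding scale_dim_le_def by (intro exI[of _ "\<lambda>i. Z (h i)"] conjI)
  qed
qed

lemma scale_dim_le_mono:
  assumes "scale_dim_le d r Y k" "k \<le> l"
  shows "scale_dim_le d r Y l"
proof -
  obtain Z where Z: "Y = (\<Union>i\<le>k. Z i)" "\<forall>i\<le>k. scale_dim_0 d r (Z i)"
    using assms(1) unfolding scale_dim_le_def by blast
  let ?Z = "\<lambda>i. if i \<le> k then Z i else {}"
  have "Y = (\<Union>i\<le>l. ?Z i)"
    using Z(1) \<open>k \<le> l\<close> by (auto split: if_splits intro: order_trans)
  moreover have "\<forall>i\<le>l. scale_dim_0 d r (?Z i)"
    using Z(2) by (simp add: scale_dim_0_empty)
  ultimately show ?thesis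
    unfolding scale_dim_le_def by blast
qed

lemma integral_APD_profile_pair_iff:
  assumes "f \<in> Pos \<rightarrow> Pos" "mono_on Pos f"
  shows "integral_APD_profile X d [\<lambda>_. n + 1, f] \<longleftrightarrow>
    (\<forall>p\<in>Pos. \<forall>q\<ge>p. \<exists>A B. X = A \<union> B \<and>
      scale_dim_le d (real p) A n \<and> scale_dim_le d (real q) B (f p - 1))"
    (is "?profile \<longleftrightarrow> ?pairs")
proof
  assume profile: ?profile
  have c: "(\<forall>m\<in>Pos. n + 1 = c) \<longleftrightarrow> c = n + 1" for c
    by (auto simp: Pos_def)
  show ?pairs
  proof (intro ballI allI impI)
    fix p q assume "p \<in> Pos" "p \<le> q"
    then have "set [p, q] \<subseteq> Pos" "sorted [p, q]"
      by (auto simp: Pos_def)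
    then obtain Y where "X = (\<Union>i<2. Y i)" "scale_dim_le d (real p) (Y 0) n"
      "\<forall>i. 1 \<le> i \<and> i < 2 \<longrightarrow>
        scale_dim_le d (real ([p, q] ! i)) (Y i) (([\<lambda>_. n + 1, f] ! i) ([p, q] ! (i - 1)) - 1)"
      using profile unfolding integral_APD_profile_def
      by (auto simp: c numeral_2_eq_2 dest!: spec[of _ "[p, q]"])
    then have "X = Y 0 \<union> Y 1 \<and> scale_dim_le d (real p) (Y 0) n \<and>
        scale_dim_le d (real q) (Y 1) (f p - 1)"
      by (auto simp: numeral_2_eq_2 lessThan_Suc)
    then show "\<exists>A B. X = A \<union> B \<and>
        scale_dim_le d (real p) A n \<and> scale_dim_le d (real q) B (f p - 1)"
      by blast
  qed
next
  assume pairs: ?pairs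
  have "\<exists>Y. X = (\<Union>i<2. Y i) \<and> scale_dim_le d (real (r ! 0)) (Y 0) n \<and>
      (\<forall>i. 1 \<le> i \<and> i < 2 \<longrightarrow>
        scale_dim_le d (real (r ! i)) (Y i) (([\<lambda>_. n + 1, f] ! i) (r ! (i - 1)) - 1))"
    if r: "length r = 2" "set r \<subseteq> Pos" "sorted r" for r
  proof -
    obtain p q where pq: "r = [p, q]"
      using r(1) by (auto simp: numeral_2_eq_2 length_Suc_conv)
    then obtain A B where AB: "X = A \<union> B" "scale_dim_le d (real p) A n"
      "scale_dim_le d (real q) B (f p - 1)"
      using pairs r by force
    have "i = 1" if "1 \<le> i \<and> i < 2" for i :: nat
      using that by simp
    then show ?thesis
      using AB by (intro exI[of _ "\<lambda>i. if i = 0 then A else B"])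
        (auto simp: pq numeral_2_eq_2 lessThan_Suc)
  qed
  moreover have "\<forall>i<2. [\<lambda>_. n + 1, f] ! i \<in> Pos \<rightarrow> Pos \<and> mono_on Pos ([\<lambda>_. n + 1, f] ! i)"
    using assms by (auto simp: less_2_cases_iff Pos_def mono_on_def)
  ultimately show ?profile
    unfolding integral_APD_profile_def
    by (intro conjI exI[of _ "n + 1"]) (auto simp: numeral_2_eq_2)
qed

section \<open>Profiles and large members of the family\<close>

text \<open>
  If \<open>\<sigma>\<close> had more elements, then \<open>\<sigma> - S\<close> would have room for the \<open>f (Max S)\<close> sets of the second part
  of a decomposition. The second scale is \<open>Max \<sigma>\<close>, so these sets can be placed at any index in
  \<open>\<sigma> - S\<close>, even at one below \<open>Max S\<close>; the \<open>n + 1\<close> sets of the first part are placed at \<open>S\<close>.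
\<close>

lemma card_le_if_profile:
  assumes pm: "infty_pseudometric X d"
    and f: "f \<in> Pos \<rightarrow> Pos"
    and profile: "\<forall>p\<in>Pos. \<forall>q\<ge>p. \<exists>A B. X = A \<union> B \<and>
      scale_dim_le d (real p) A n \<and> scale_dim_le d (real q) B (f p - 1)"
    and S: "S \<subseteq> Pos" "card S = Suc n"
    and \<sigma>: "\<sigma> \<in> trasdim_family X d" "S \<subseteq> \<sigma>"
  shows "card \<sigma> \<le> n + f (Max S)"
proof (rule ccontr)
  assume large: "\<not> card \<sigma> \<le> n + f (Max S)"
  have \<sigma>_Fin: "\<sigma> \<in> Fin Pos"
    using \<sigma> by (auto simp: trasdim_family_def)
  then have fin: "finite \<sigma>" "finite S" and S0: "S \<noteq> {}"
    using \<sigma> S by (auto simp: Fin_def intro: finite_subset)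
  have p: "Max S \<in> Pos"
    using S S0 fin Max_in by blast
  have q: "Max S \<le> Max \<sigma>"
    using \<sigma> S0 fin by (intro Max_mono)
  obtain A B where AB: "X = A \<union> B" "scale_dim_le d (real (Max S)) A n"
    "scale_dim_le d (real (Max \<sigma>)) B (f (Max S) - 1)"
    using profile p q by blast
  have fpos: "1 \<le> f (Max S)"
    using f p by (auto simp: Pos_def)
  have card_T: "f (Max S) \<le> card (\<sigma> - S)"
    using large S \<sigma> fin by (simp add: card_Diff_subset)
  have "\<sigma> - S \<noteq> {}"
    using card_T fpos by force
  moreover have "scale_dim_le d (real (Max \<sigma>)) B (card (\<sigma> - S) - 1)"
    using scale_dim_le_mono[OF AB(3)] card_T by simp
  ultimately obtain W where W: "B = (\<Union>i\<in>\<sigma> - S. W i)" "\<forall>i\<in>\<sigma> - S. scale_dim_0 d (real (Max \<sigma>)) (W i)"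
    using scale_dim_le_card_iff[of "\<sigma> - S" d "real (Max \<sigma>)" B] fin by auto
  have "scale_dim_le d (real (Max S)) A (card S - 1)"
    using AB(2) S by simp
  then obtain V where V: "A = (\<Union>i\<in>S. V i)" "\<forall>i\<in>S. scale_dim_0 d (real (Max S)) (V i)"
    using scale_dim_le_card_iff[OF fin(2) S0, of d "real (Max S)" A] by auto
  let ?Y = "\<lambda>i. if i \<in> S then V i else W i"
  have "X = (\<Union>i\<in>\<sigma>. ?Y i)"
    using AB(1) V(1) W(1) \<open>S \<subseteq> \<sigma>\<close> by (auto split: if_splits)
  moreover have "scale_dim_0 d (real i) (?Y i)" if "i \<in> \<sigma>" for i
  proof (cases "i \<in> S")
    case True
    then show ?thesis
      using V(2) fin by (auto intro: scale_dim_0_subset)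
  next
    case False
    then show ?thesis
      using W(2) fin that by (auto intro: scale_dim_0_subset)
  qed
  ultimately have "\<sigma> \<notin> trasdim_family X d"
    unfolding not_in_trasdim_family_iff[OF pm \<sigma>_Fin] by blast
  then show False
    using \<sigma> by simp
qed

text \<open>
  The bound \<open>m\<close> for \<open>S = {p..p + n}\<close> makes \<open>S \<union> T\<close> coverable for every set \<open>T\<close> of \<open>m\<close> positive
  integers disjoint from \<open>S\<close>. Choosing all of \<open>T\<close> at or above \<open>q\<close> gives the second part scale \<open>q\<close>, at no
  cost in the number of its sets.
\<close>

lemma decomposition_if_card_le:
  assumes pm: "infty_pseudometric X d"
    and p: "p \<in> Pos" and "1 \<le> m"
    and bound: "\<And>\<sigma>. \<sigma> \<in> trasdim_family X d \<Longrightarrow> {p..p + n} \<subseteq> \<sigma> \<Longrightarrow> card \<sigma> \<le> m"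
  shows "\<exists>A B. X = A \<union> B \<and>
    scale_dim_le d (real p) A n \<and> scale_dim_le d (real q) B (m - 1)"
proof -
  define S where "S = {p..p + n}"
  \<comment> \<open>The offset \<open>p + n + 1\<close> keeps \<open>T\<close> disjoint from \<open>S\<close> when \<open>q \<le> p + n\<close>.\<close>
  define s where "s = max q (p + n + 1)"
  define T where "T = {s..<s + m}"
  have disj: "S \<inter> T = {}"
    by (auto simp: S_def T_def s_def)
  have card: "card S = Suc n" "card T = m"
    by (simp_all add: S_def T_def)
  have ST: "S \<union> T \<in> Fin Pos"
    using p by (auto simp: Fin_def Pos_def S_def T_def s_def)
  have fin: "finite S" "finite T" "S \<noteq> {}" "T \<noteq> {}"
    using \<open>1 \<le> m\<close> by (auto simp: S_def T_def)
  have "card (S \<union> T) > m"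
    using card disj fin by (simp add: card_Un_disjoint)
  then have "S \<union> T \<notin> trasdim_family X d"
    using bound[of "S \<union> T"] by (auto simp: S_def)
  then obtain Y where Y: "X = (\<Union>i\<in>S \<union> T. Y i)" "\<forall>i\<in>S \<union> T. scale_dim_0 d (real i) (Y i)"
    unfolding not_in_trasdim_family_iff[OF pm ST] by blast
  have "\<forall>i\<in>S. scale_dim_0 d (real p) (Y i)"
    using Y(2) by (auto simp: S_def intro: scale_dim_0_subset)
  then have "scale_dim_le d (real p) (\<Union>i\<in>S. Y i) n"
    using scale_dim_le_card_iff[of S d "real p" "\<Union>i\<in>S. Y i"] fin card by auto
  moreover have "\<forall>i\<in>T. scale_dim_0 d (real q) (Y i)"
    using Y(2) by (auto simp: T_def s_def intro: scale_dim_0_subset)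
  then have "scale_dim_le d (real q) (\<Union>i\<in>T. Y i) (m - 1)"
    using scale_dim_le_card_iff[of T d "real q" "\<Union>i\<in>T. Y i"] fin card by auto
  moreover have "X = (\<Union>i\<in>S. Y i) \<union> (\<Union>i\<in>T. Y i)"
    using Y(1) by blast
  ultimately show ?thesis
    by blast
qed

theorem theorem3p2:
  fixes X :: "'a set" and d :: "'a \<Rightarrow> 'a \<Rightarrow> ennreal" and n :: nat
  assumes "infty_pseudometric X d"
  shows "(\<exists>f. f \<in> Pos \<rightarrow> Pos \<and> mono_on Pos f \<and> integral_APD_profile X d [\<lambda>_. n + 1, f])
    \<longleftrightarrow> trasdim X d \<le> top.Value (omega_plus n)"
proof -
  have "trasdim_family X d \<subseteq> Fin Pos"
    by (auto simp: trasdim_family_def)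
  then have trasdim: "trasdim X d \<le> top.Value (omega_plus n) \<longleftrightarrow>
      (\<forall>S\<subseteq>Pos. card S = Suc n \<longrightarrow> (\<exists>m. \<forall>\<sigma>\<in>trasdim_family X d. S \<subseteq> \<sigma> \<longrightarrow> card \<sigma> \<le> m))"
    by (simp add: trasdim_def Ord_le_Value_iff Ord_le_omega_plus_iff)
  show ?thesis
  proof
    assume "\<exists>f. f \<in> Pos \<rightarrow> Pos \<and> mono_on Pos f \<and> integral_APD_profile X d [\<lambda>_. n + 1, f]"
    then obtain f where f: "f \<in> Pos \<rightarrow> Pos" "mono_on Pos f"
      and profile: "integral_APD_profile X d [\<lambda>_. n + 1, f]"
      by blast
    show "trasdim X d \<le> top.Value (omega_plus n)"
      unfolding trasdim
      using card_le_if_profile[OF assms f(1) profile[unfolded integral_APD_profile_pair_iff[OF f]]]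
      by blast
  next
    assume "trasdim X d \<le> top.Value (omega_plus n)"
    moreover have "{p..p + n} \<subseteq> Pos \<and> card {p..p + n} = Suc n" if "p \<in> Pos" for p
      using that by (auto simp: Pos_def)
    ultimately have "\<forall>p\<in>Pos. \<exists>m. \<forall>\<sigma>\<in>trasdim_family X d. {p..p + n} \<subseteq> \<sigma> \<longrightarrow> card \<sigma> \<le> m"
      unfolding trasdim by blast
    then obtain m where
      m: "\<forall>p\<in>Pos. \<forall>\<sigma>\<in>trasdim_family X d. {p..p + n} \<subseteq> \<sigma> \<longrightarrow> card \<sigma> \<le> m p"
      by metis
    \<comment> \<open>The bounds \<open>m p\<close> need not be monotone or positive; their partial sums plus one are.\<close>
    define f where "f p = 1 + (\<Sum>j\<le>p. m j)" for p
    have f: "f \<in> Pos \<rightarrow> Pos" "mono_on Pos f"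
      by (auto simp: f_def Pos_def mono_on_def intro!: sum_mono2)
    have "m p \<le> f p" for p
      using member_le_sum[of p "{..p}" m] by (simp add: f_def)
    then have "card \<sigma> \<le> f p" if "p \<in> Pos" "\<sigma> \<in> trasdim_family X d" "{p..p + n} \<subseteq> \<sigma>" for p \<sigma>
      using m that le_trans by blast
    then have "integral_APD_profile X d [\<lambda>_. n + 1, f]"
      unfolding integral_APD_profile_pair_iff[OF f]
      by (intro ballI allI impI decomposition_if_card_le[OF assms]) (auto simp: f_def)
    with f show "\<exists>f. f \<in> Pos \<rightarrow> Pos \<and> mono_on Pos f \<and>
        integral_APD_profile X d [\<lambda>_. n + 1, f]"
      by blast
  qed
qed

end
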